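(* Let $\Gamma=(\Omega,E)$ be a strongly regular graph, $G=\mathrm{Aut}(\Gamma)$, and $\omega\in\Omega$ a vertex such that $T_{0,\omega}=T_\omega=\tilde T_\omega$. Let $\Delta_1$ be the set of neighbours of $\omega$ and $\Delta_2$ the set of vertices other than $\omega$ not adjacent to $\omega$. Then one of the following holds: (a) $G$ is transitive of rank $3$ on $\Omega$; (b) $G=G_\omega$, and $G$ is transitive on each of $\{\omega\}$, $\Delta_1$ and $\Delta_2$.
   Context: Let $A_0=I$, $A_1$ the adjacency matrix of $\Gamma$, $A_2=J-I-A_1$. For $i=0,1,2$, $E^*_{i,\omega}$ is the diagonal matrix whose diagonal is the $\omega$-row of $A_i$. $T_\omega$ is the subalgebra of $M_{|\Omega|}(\mathbb C)$ generated by $A_0,A_1,A_2,E^*_{0,\omega},E^*_{1,\omega},E^*_{2,\omega}$ (the Terwilliger algebra), $T_{0,\omega}$ is the linear span of $\{E^*_{i,\omega}A_jE^*_{k,\omega}:0\le i,j,k\le 2\}$, and $\tilde T_\omega$ is the algebra of all complex matrices commuting with the permutation matrices of all elements of the stabilizer $G_\omega$. A transitive permutation group has rank $3$ if a point stabilizer has exactly $3$ orbits. *)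

theory Defs
  imports "HOL-Analysis.Analysis" "HOL-Algebra.Group_Action"
begin

text \<open>
  A graph is given by its edge relation on a finite vertex type; an undirected edge
  between \<open>x\<close> and \<open>y\<close> is represented by both pairs \<open>(x, y)\<close> and \<open>(y, x)\<close>.
\<close>

definition simple_graph :: "('v \<times> 'v) set \<Rightarrow> bool"
  where "simple_graph E \<longleftrightarrow> sym E \<and> irrefl E"

definition neighbours :: "('v \<times> 'v) set \<Rightarrow> 'v \<Rightarrow> 'v set"
  where "neighbours E x = {y. (x, y) \<in> E}"

definition non_neighbours :: "('v \<times> 'v) set \<Rightarrow> 'v \<Rightarrow> 'v set"
  where "non_neighbours E x = {y. y \<noteq> x \<and> (x, y) \<notin> E}"

text \<open>As usual, complete and edgeless graphs are not regarded as strongly regular.\<close>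

definition strongly_regular_params :: "('v \<times> 'v) set \<Rightarrow> nat \<Rightarrow> nat \<Rightarrow> nat \<Rightarrow> bool"
  where "strongly_regular_params E k l m \<longleftrightarrow>
    simple_graph E \<and>
    (\<exists>x y. (x, y) \<in> E) \<and>
    (\<exists>x y. x \<noteq> y \<and> (x, y) \<notin> E) \<and>
    (\<forall>x. card (neighbours E x) = k) \<and>
    (\<forall>x y. (x, y) \<in> E \<longrightarrow> card (neighbours E x \<inter> neighbours E y) = l) \<and>
    (\<forall>x y. x \<noteq> y \<and> (x, y) \<notin> E \<longrightarrow> card (neighbours E x \<inter> neighbours E y) = m)"

definition strongly_regular :: "('v \<times> 'v) set \<Rightarrow> bool"
  where "strongly_regular E \<longleftrightarrow> (\<exists>k l m. strongly_regular_params E k l m)"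

definition graph_aut :: "('v \<times> 'v) set \<Rightarrow> ('v \<Rightarrow> 'v) monoid"
  where "graph_aut E = BijGroup UNIV
    \<lparr>carrier := {g \<in> carrier (BijGroup UNIV). \<forall>x y. (g x, g y) \<in> E \<longleftrightarrow> (x, y) \<in> E}\<rparr>"

text \<open>
  A permutation group acts on its points by the identity map \<open>\<lambda>g. g\<close>.  Its action on a set
  \<open>X\<close> of points is obtained by restricting each permutation to \<open>X\<close>; being an action on \<open>X\<close>
  includes that \<open>X\<close> is invariant.
\<close>

definition transitive_on :: "('v \<Rightarrow> 'v) monoid \<Rightarrow> 'v set \<Rightarrow> bool"
  where "transitive_on G X \<longleftrightarrow> transitive_action G X (\<lambda>g. restrict g X)"

definition point_stabilizer :: "('v \<Rightarrow> 'v) monoid \<Rightarrow> 'v \<Rightarrow> ('v \<Rightarrow> 'v) monoid"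
  where "point_stabilizer G x = G\<lparr>carrier := stabilizer G (\<lambda>g. g) x\<rparr>"

definition transitive_of_rank :: "('v \<Rightarrow> 'v) monoid \<Rightarrow> nat \<Rightarrow> bool"
  where "transitive_of_rank G r \<longleftrightarrow>
    transitive_on G UNIV \<and> (\<forall>x. card (orbits (point_stabilizer G x) UNIV (\<lambda>g. g)) = r)"

text \<open>
  On \<open>complex^'v^'v\<close> the overloaded \<open>*\<^sub>R\<close> and \<open>*\<close> are real scaling and the entrywise product.
  The complex vector space structure is set up here; the matrix product is \<open>**\<close>.
\<close>

definition cmat_scale :: "complex \<Rightarrow> complex^'v^'v \<Rightarrow> complex^'v^'v"
  where "cmat_scale c M = (\<chi> x y. c * M $ x $ y)"

global_interpretation cmat: vector_space cmat_scale
  by unfold_locales (simp_all add: cmat_scale_def vec_eq_iff algebra_simps)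

definition matrix_subalgebra :: "(complex^'v^'v) set \<Rightarrow> bool"
  where "matrix_subalgebra S \<longleftrightarrow>
    cmat.subspace S \<and> mat 1 \<in> S \<and> (\<forall>M\<in>S. \<forall>N\<in>S. M ** N \<in> S)"

definition adj_matrix :: "('v \<times> 'v) set \<Rightarrow> complex^'v^'v"
  where "adj_matrix E = (\<chi> x y. if (x, y) \<in> E then 1 else 0)"

definition all_ones :: "complex^'v^'v"
  where "all_ones = (\<chi> x y. 1)"

text \<open>Only the indices \<open>0, 1, 2\<close> are meaningful below.\<close>

definition rel_matrix :: "('v \<times> 'v) set \<Rightarrow> nat \<Rightarrow> complex^'v^'v"
  where "rel_matrix E i =
    (if i = 0 then mat 1
     else if i = 1 then adj_matrix E
     else all_ones - mat 1 - adj_matrix E)"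

definition dual_idempotent :: "('v \<times> 'v) set \<Rightarrow> 'v \<Rightarrow> nat \<Rightarrow> complex^'v^'v"
  where "dual_idempotent E w i = (\<chi> x y. if x = y then rel_matrix E i $ w $ x else 0)"

definition terwilliger_algebra :: "('v::finite \<times> 'v) set \<Rightarrow> 'v \<Rightarrow> (complex^'v^'v) set"
  where "terwilliger_algebra E w =
    matrix_subalgebra hull (rel_matrix E ` {0..2} \<union> dual_idempotent E w ` {0..2})"

definition triple_product_span :: "('v::finite \<times> 'v) set \<Rightarrow> 'v \<Rightarrow> (complex^'v^'v) set"
  where "triple_product_span E w =
    cmat.span {dual_idempotent E w i ** rel_matrix E j ** dual_idempotent E w k | i j k.
      i \<le> 2 \<and> j \<le> 2 \<and> k \<le> 2}"

definition perm_matrix :: "('v \<Rightarrow> 'v) \<Rightarrow> complex^'v^'v"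
  where "perm_matrix g = (\<chi> x y. if x = g y then 1 else 0)"

definition stabilizer_centralizer_algebra ::
    "('v::finite \<times> 'v) set \<Rightarrow> 'v \<Rightarrow> (complex^'v^'v) set"
  where "stabilizer_centralizer_algebra E w =
    {M. \<forall>g \<in> carrier (point_stabilizer (graph_aut E) w).
          M ** perm_matrix g = perm_matrix g ** M}"

end

theory Submission
  imports Defs
begin

text \<open>
  All diagonal entries of a matrix in \<open>T\<^sub>0\<close> over \<open>\<Delta>\<^sub>i\<close> agree, while the diagonal indicator matrix of
  a \<open>G\<^sub>\<omega>\<close>-orbit lies in the centralizer algebra; so the hypothesis makes \<open>{\<omega>}\<close>, \<open>\<Delta>\<^sub>1\<close>, \<open>\<Delta>\<^sub>2\<close> the
  orbits of \<open>G\<^sub>\<omega>\<close>.  Hence the \<open>G\<close>-orbit \<open>X\<close> of \<open>\<omega>\<close> is \<open>{\<omega>}\<close>, everything, \<open>{\<omega>} \<union> \<Delta>\<^sub>1\<close> or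
  \<open>{\<omega>} \<union> \<Delta>\<^sub>2\<close>.  In the third case \<open>X\<close> is a clique, so two adjacent vertices have \<open>k - 1\<close> common
  neighbours and the graph is a disjoint union of complete graphs of the same size; in the fourth
  case \<open>X\<close> is a coclique, non-adjacent vertices have the same neighbours, and the graph is complete
  multipartite with parts of the same size.  Either way \<open>X\<close> is a class of an equivalence relation
  whose classes can be interchanged by automorphisms, so that \<open>X\<close> must be everything.
\<close>

section \<open>Automorphism groups and their actions\<close>

lemma mem_carrier_graph_aut:
  "g \<in> carrier (graph_aut E) \<longleftrightarrow> bij g \<and> (\<forall>x y. (g x, g y) \<in> E \<longleftrightarrow> (x, y) \<in> E)"
  by (auto simp: graph_aut_def BijGroup_def Bij_def)

lemma mult_graph_aut:
  assumes "g \<in> carrier (graph_aut E)" "h \<in> carrier (graph_aut E)"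
  shows "g \<otimes>\<^bsub>graph_aut E\<^esub> h = g \<circ> h"
  using assms by (auto simp: mem_carrier_graph_aut graph_aut_def BijGroup_def Bij_def compose_def)

lemma comp_graph_aut:
  assumes "g \<in> carrier (graph_aut E)" "h \<in> carrier (graph_aut E)"
  shows "g \<circ> h \<in> carrier (graph_aut E)"
  using assms by (auto simp: mem_carrier_graph_aut bij_comp)

lemma id_graph_aut: "id \<in> carrier (graph_aut E)"
  by (simp add: mem_carrier_graph_aut)

lemma inv_graph_aut:
  assumes "g \<in> carrier (graph_aut E)"
  shows "inv_into UNIV g \<in> carrier (graph_aut E)"
proof -
  have g: "bij g" "\<And>x y. (g x, g y) \<in> E \<longleftrightarrow> (x, y) \<in> E"
    using assms by (auto simp: mem_carrier_graph_aut)
  have "(inv_into UNIV g x, inv_into UNIV g y) \<in> E \<longleftrightarrow> (x, y) \<in> E" for x y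
    using g(2)[of "inv_into UNIV g x" "inv_into UNIV g y"] bij_is_surj[OF g(1)]
    by (simp add: surj_f_inv_f)
  with bij_imp_bij_inv[OF g(1)] show ?thesis
    by (simp add: mem_carrier_graph_aut)
qed

lemma group_graph_aut: "group (graph_aut E)"
proof (rule groupI)
  have one: "\<one>\<^bsub>graph_aut E\<^esub> = id"
    by (auto simp: graph_aut_def BijGroup_def)
  show "\<one>\<^bsub>graph_aut E\<^esub> \<in> carrier (graph_aut E)"
    by (simp add: one id_graph_aut)
  show "x \<otimes>\<^bsub>graph_aut E\<^esub> y \<in> carrier (graph_aut E)"
    if "x \<in> carrier (graph_aut E)" "y \<in> carrier (graph_aut E)" for x y
    using that by (simp add: mult_graph_aut comp_graph_aut)
  show "x \<otimes>\<^bsub>graph_aut E\<^esub> y \<otimes>\<^bsub>graph_aut E\<^esub> z = x \<otimes>\<^bsub>graph_aut E\<^esub> (y \<otimes>\<^bsub>graph_aut E\<^esub> z)"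
    if "x \<in> carrier (graph_aut E)" "y \<in> carrier (graph_aut E)" "z \<in> carrier (graph_aut E)"
    for x y z
    using that by (simp add: mult_graph_aut comp_graph_aut comp_assoc)
  show "\<one>\<^bsub>graph_aut E\<^esub> \<otimes>\<^bsub>graph_aut E\<^esub> x = x" if "x \<in> carrier (graph_aut E)" for x
    using that by (simp add: one mult_graph_aut id_graph_aut)
  show "\<exists>y\<in>carrier (graph_aut E). y \<otimes>\<^bsub>graph_aut E\<^esub> x = \<one>\<^bsub>graph_aut E\<^esub>"
    if "x \<in> carrier (graph_aut E)" for x
  proof
    show "inv_into UNIV x \<otimes>\<^bsub>graph_aut E\<^esub> x = \<one>\<^bsub>graph_aut E\<^esub>"
      using mult_graph_aut[OF inv_graph_aut[OF that] that] that
      by (simp add: one mem_carrier_graph_aut bij_is_inj)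
  qed (simp add: that inv_graph_aut)
qed

lemma transitive_on_graph_autI:
  assumes invariant: "\<And>g. g \<in> carrier (graph_aut E) \<Longrightarrow> g ` X = X"
    and transitive: "\<And>x y. x \<in> X \<Longrightarrow> y \<in> X \<Longrightarrow> \<exists>g\<in>carrier (graph_aut E). g x = y"
  shows "transitive_on (graph_aut E) X"
proof -
  have Bij: "restrict g X \<in> Bij X" if "g \<in> carrier (graph_aut E)" for g
  proof -
    have "inj_on g X"
      using that by (auto simp: mem_carrier_graph_aut intro: inj_on_subset bij_is_inj)
    with invariant[OF that] show ?thesis
      by (auto simp: Bij_def bij_betw_def inj_on_def)
  qed
  have "(\<lambda>g. restrict g X) \<in> hom (graph_aut E) (BijGroup X)"
  proof (rule homI)
    fix g h assume gh: "g \<in> carrier (graph_aut E)" "h \<in> carrier (graph_aut E)"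
    have "restrict (g \<circ> h) X = compose X (restrict g X) (restrict h X)"
      using invariant[OF gh(2)] by (auto simp: compose_def fun_eq_iff)
    then show "restrict (g \<otimes>\<^bsub>graph_aut E\<^esub> h) X = restrict g X \<otimes>\<^bsub>BijGroup X\<^esub> restrict h X"
      using gh by (simp add: mult_graph_aut Bij BijGroup_def)
  qed (simp add: Bij BijGroup_def)
  then have "group_hom (graph_aut E) (BijGroup X) (\<lambda>g. restrict g X)"
    by (simp add: group_hom_def group_hom_axioms_def group_graph_aut group_BijGroup)
  then have "group_action (graph_aut E) X (\<lambda>g. restrict g X)"
    by (rule group_action.intro)
  then show ?thesis
    unfolding transitive_on_def
    by (rule transitive_action.intro) (unfold_locales, use transitive in auto)
qed

lemma carrier_point_stabilizer:
  "carrier (point_stabilizer G x) = {g \<in> carrier G. g x = x}"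
  by (simp add: point_stabilizer_def stabilizer_def)

text \<open>The stabilizers of two points of one orbit are conjugate.\<close>

lemma card_orbits_point_stabilizer_eq:
  assumes g: "g \<in> carrier (graph_aut E)"
  shows "card (orbits (point_stabilizer (graph_aut E) (g x)) UNIV (\<lambda>g. g)) =
    card (orbits (point_stabilizer (graph_aut E) x) UNIV (\<lambda>g. g))"
proof -
  let ?orb = "\<lambda>x. orbit (point_stabilizer (graph_aut E) x) (\<lambda>g. g)"
  let ?i = "inv_into UNIV g"
  have bij: "bij g"
    using g by (simp add: mem_carrier_graph_aut)
  then have gi: "g (?i a) = a" "?i (g a) = a" for a
    by (simp_all add: bij_is_inj bij_is_surj surj_f_inv_f)
  have i: "?i \<in> carrier (graph_aut E)"
    using g by (rule inv_graph_aut)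
  \<comment> \<open>Conjugation by \<open>g\<close> matches the two stabilizers: an \<open>h\<close>
    fixing \<open>g x\<close> gives \<open>?i \<circ> (h \<circ> g)\<close> fixing \<open>x\<close>,
    and conversely.\<close>
  have orb: "?orb (g x) (g a) = g ` ?orb x a" for a
  proof (intro equalityI subsetI)
    fix b assume "b \<in> ?orb (g x) (g a)"
    then obtain h where h: "h \<in> carrier (graph_aut E)" "h (g x) = g x" "b = h (g a)"
      by (auto simp: orbit_def carrier_point_stabilizer)
    then have "?i \<circ> (h \<circ> g) \<in> carrier (graph_aut E)" "(?i \<circ> (h \<circ> g)) x = x"
      by (auto intro!: comp_graph_aut g i simp: gi)
    then have "(?i \<circ> (h \<circ> g)) a \<in> ?orb x a"
      unfolding orbit_def carrier_point_stabilizer by blast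
    moreover have "b = g ((?i \<circ> (h \<circ> g)) a)"
      by (simp add: h gi)
    ultimately show "b \<in> g ` ?orb x a"
      by blast
  next
    fix b assume "b \<in> g ` ?orb x a"
    then obtain h where h: "h \<in> carrier (graph_aut E)" "h x = x" "b = g (h a)"
      by (auto simp: orbit_def carrier_point_stabilizer)
    then have "g \<circ> (h \<circ> ?i) \<in> carrier (graph_aut E)" "(g \<circ> (h \<circ> ?i)) (g x) = g x"
      by (auto intro!: comp_graph_aut g i simp: gi)
    then have "(g \<circ> (h \<circ> ?i)) (g a) \<in> ?orb (g x) (g a)"
      unfolding orbit_def carrier_point_stabilizer by blast
    then show "b \<in> ?orb (g x) (g a)"
      by (simp add: h gi)
  qed
  have "orbits (point_stabilizer (graph_aut E) (g x)) UNIV (\<lambda>g. g) = range (?orb (g x))"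
    by (auto simp: orbits_def)
  also have "\<dots> = range (\<lambda>a. ?orb (g x) (g a))"
    using bij_is_surj[OF bij] by (metis image_image)
  also have "\<dots> = (`) g ` orbits (point_stabilizer (graph_aut E) x) UNIV (\<lambda>g. g)"
    by (auto simp: orb orbits_def)
  finally show ?thesis
    using bij_is_inj[OF bij] by (simp add: card_image inj_on_def inj_image_eq_iff)
qed

section \<open>Orbits of the point stabilizer\<close>

text \<open>The dual idempotents are diagonal, so the diagonal entry of a generator at
  \<open>x\<close> is a product of three numbers that depend only on the relation of
  \<open>w\<close> to \<open>x\<close> and of \<open>x\<close> to itself. Equality of two entries is
  a linear condition and passes to the span.\<close>

lemma triple_product_span_diagonal:
  assumes "M \<in> triple_product_span E w"
    and eq: "\<And>i. rel_matrix E i $ w $ y = rel_matrix E i $ w $ z"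
    and diag: "\<And>i. rel_matrix E i $ y $ y = rel_matrix E i $ z $ z"
  shows "M $ y $ y = M $ z $ z"
proof -
  have gen: "(dual_idempotent E w i ** rel_matrix E j ** dual_idempotent E w k) $ x $ x =
      rel_matrix E i $ w $ x * rel_matrix E j $ x $ x * rel_matrix E k $ w $ x" for i j k x
    by (simp add: matrix_matrix_mult_def dual_idempotent_def if_distrib if_distribR cong: if_cong)
  show ?thesis
    using assms(1) unfolding triple_product_span_def
  proof (induction rule: cmat.span_induct)
    case base
    show "cmat.subspace {M. M $ y $ y = M $ z $ z}"
      by (rule cmat.subspaceI) (auto simp: cmat_scale_def)
  next
    case (step M)
    then show ?case
      by (auto simp: gen eq diag)
  qed
qed

text \<open>Both products are supported on the positions with \<open>x = g y\<close>; one has entry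
  1 there when \<open>x \<in> X\<close>, the other when \<open>y \<in> X\<close>. Invariance of
  \<open>X\<close> says that these agree.\<close>

lemma diag_indicator_mem_centralizer:
  fixes E :: "('v::finite \<times> 'v) set"
  assumes "\<And>g x. g \<in> carrier (point_stabilizer (graph_aut E) w) \<Longrightarrow> g x \<in> X \<longleftrightarrow> x \<in> X"
  shows "(\<chi> x y. if x = y \<and> x \<in> X then 1 else 0) \<in> stabilizer_centralizer_algebra E w"
proof -
  have "(\<Sum>z\<in>UNIV. (if x = z \<and> x \<in> X then 1 else 0) * (if z = g y then 1 else 0)) =
      (\<Sum>z\<in>UNIV. (if x = g z then 1 else 0) * (if z = y \<and> z \<in> X then 1 else (0::complex)))"
    if "g \<in> carrier (point_stabilizer (graph_aut E) w)" for g x y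
  proof -
    have "(\<Sum>z\<in>UNIV. (if x = z \<and> x \<in> X then 1 else 0) * (if z = g y then 1 else 0)) =
        (\<Sum>z\<in>UNIV. if z = x then if x \<in> X \<and> x = g y then 1 else (0::complex) else 0)"
      by (intro sum.cong) auto
    moreover have "(\<Sum>z\<in>UNIV. (if x = g z then 1 else 0) * (if z = y \<and> z \<in> X then 1 else 0)) =
        (\<Sum>z\<in>UNIV. if z = y then if y \<in> X \<and> x = g y then 1 else (0::complex) else 0)"
      by (intro sum.cong) auto
    ultimately show ?thesis
      using assms[OF that] by auto
  qed
  then show ?thesis
    by (simp add: stabilizer_centralizer_algebra_def matrix_matrix_mult_def perm_matrix_def vec_eq_iff)
qed

text \<open>The last two hypotheses put \<open>y\<close> and \<open>z\<close> in the same cell of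
  the partition by relation to \<open>w\<close>. The diagonal indicator of the stabilizer orbit of
  \<open>y\<close> lies in the centralizer algebra, hence in the span, so its entry 1 at
  \<open>y\<close> recurs at \<open>z\<close>.\<close>

lemma stabilizer_orbit_if_span_eq_centralizer:
  fixes E :: "('v::finite \<times> 'v) set"
  assumes "triple_product_span E w = stabilizer_centralizer_algebra E w" "irrefl E"
    and "y = w \<longleftrightarrow> z = w" "(w, y) \<in> E \<longleftrightarrow> (w, z) \<in> E"
  shows "\<exists>g\<in>carrier (graph_aut E). g w = w \<and> g y = z"
proof -
  define X where "X = {g y | g. g \<in> carrier (graph_aut E) \<and> g w = w}"
  define D :: "complex^'v^'v" where "D = (\<chi> x y. if x = y \<and> x \<in> X then 1 else 0)"
  have fwd: "g x \<in> X" if g: "g \<in> carrier (graph_aut E)" "g w = w" and x: "x \<in> X" for g x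
  proof -
    obtain h where h: "h \<in> carrier (graph_aut E)" "h w = w" "x = h y"
      using x by (auto simp: X_def)
    have "g \<circ> h \<in> carrier (graph_aut E)" "(g \<circ> h) w = w" "g x = (g \<circ> h) y"
      using g h by (simp_all add: comp_graph_aut)
    then show ?thesis
      unfolding X_def by blast
  qed
  \<comment> \<open>The converse of \<open>fwd\<close> is \<open>fwd\<close> for the inverse of
    \<open>g\<close>, which also fixes \<open>w\<close>.\<close>
  have "g x \<in> X \<longleftrightarrow> x \<in> X" if g: "g \<in> carrier (graph_aut E)" "g w = w" for g x
  proof -
    have "inj g"
      using g by (simp add: mem_carrier_graph_aut bij_is_inj)
    then have "inv_into UNIV g w = w" "inv_into UNIV g (g x) = x"
      using g(2) by (metis inv_f_f)+
    then show ?thesis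
      using fwd[OF g] fwd[of "inv_into UNIV g" "g x"] inv_graph_aut[OF g(1)] by auto
  qed
  then have "D \<in> stabilizer_centralizer_algebra E w"
    unfolding D_def by (intro diag_indicator_mem_centralizer) (auto simp: carrier_point_stabilizer)
  then have "D $ y $ y = D $ z $ z"
    using assms
    by (intro triple_product_span_diagonal[of D E w])
      (auto simp: rel_matrix_def mat_def adj_matrix_def all_ones_def irrefl_def)
  moreover have "id y \<in> X"
    unfolding X_def using id_graph_aut[of E] id_apply[of w] by blast
  ultimately have "z \<in> X"
    by (auto simp: D_def split: if_splits)
  then show ?thesis
    by (auto simp: X_def)
qed

section \<open>Interchanging the classes of an equivalence relation\<close>

text \<open>For distinct classes, a bijection between them, its inverse on the second class and the
  identity elsewhere form an involution that permutes the classes.\<close>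

lemma equiv_classes_swap:
  assumes R: "equiv UNIV R" and fin: "finite (R `` {x})" "finite (R `` {y})"
    and card: "card (R `` {x}) = card (R `` {y})"
  shows "\<exists>g. bij g \<and> (\<forall>a b. (g a, g b) \<in> R \<longleftrightarrow> (a, b) \<in> R) \<and> g x \<in> R `` {y}"
proof (cases "(x, y) \<in> R")
  case True
  then show ?thesis
    using R by (intro exI[of _ id]) (auto dest: equivE symD)
next
  case False
  obtain f where f: "bij_betw f (R `` {x}) (R `` {y})"
    using finite_same_card_bij[OF fin card] by blast
  let ?f' = "inv_into (R `` {x}) f"
  have f': "bij_betw ?f' (R `` {y}) (R `` {x})"
    using f by (rule bij_betw_inv_into)
  have sym: "(a, b) \<in> R \<Longrightarrow> (b, a) \<in> R" and trans: "(a, b) \<in> R \<Longrightarrow> (b, c) \<in> R \<Longrightarrow> (a, c) \<in> R"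
    and refl: "(a, a) \<in> R" for a b c
    using R by (auto simp: equiv_def refl_on_def dest: symD transD)
  define g where "g a = (if (x, a) \<in> R then f a else if (y, a) \<in> R then ?f' a else a)" for a
  have xy: "\<not> ((x, a) \<in> R \<and> (y, a) \<in> R)" for a
    using False sym trans by blast
  have fx: "(y, f a) \<in> R" "?f' (f a) = a" if "(x, a) \<in> R" for a
    using that f bij_betw_inv_into_left[OF f] by (auto simp: bij_betw_def)
  have fy: "(x, ?f' a) \<in> R" "f (?f' a) = a" if "(y, a) \<in> R" for a
    using that f' bij_betw_inv_into_right[OF f] by (auto simp: bij_betw_def)
  have gx: "(x, g a) \<in> R \<longleftrightarrow> (y, a) \<in> R" and gy: "(y, g a) \<in> R \<longleftrightarrow> (x, a) \<in> R" for a
    using xy fx(1) fy(1) by (auto simp: g_def)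
  have "g (g a) = a" for a
    \<comment> \<open>Disjointness of the two classes, at \<open>a\<close> and at its image, decides
      which branch of \<open>g\<close> applies each time.\<close>
    using xy[of a] xy[of "f a"] xy[of "?f' a"] fx[of a] fy[of a] by (auto simp: g_def)
  then have "bij g"
    by (intro o_bij[of g g]) auto
  moreover have "(g a, g b) \<in> R \<longleftrightarrow> (a, b) \<in> R" for a b
  proof -
    consider "(x, a) \<in> R" | "(y, a) \<in> R" | "(x, a) \<notin> R" "(y, a) \<notin> R"
      by blast
    then show ?thesis
    proof cases
      case 1
      then show ?thesis
        using gy[of a] gy[of b] sym trans by blast
    next
      case 2
      then show ?thesis
        using gx[of a] gx[of b] sym trans by blast
    next
      case 3
      then have ga: "g a = a"
        by (simp add: g_def)
      show ?thesis
      proof (cases "(x, b) \<in> R \<or> (y, b) \<in> R")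
        case True
        \<comment> \<open>\<open>b\<close> and \<open>g b\<close> both lie in the union of the two
          classes while \<open>a\<close> lies outside it, so both sides are false.\<close>
        then have "(x, g b) \<in> R \<or> (y, g b) \<in> R"
          using gx gy by blast
        with True 3 ga show ?thesis
          using sym trans by metis
      next
        case False
        then show ?thesis
          using 3 by (simp add: ga g_def)
      qed
    qed
  qed
  moreover have "g x \<in> R `` {y}"
    using gy[of x] refl by simp
  ultimately show ?thesis
    by blast
qed

text \<open>Swapping the classes of \<open>w\<close> and \<open>y\<close> is a graph automorphism by
  \<open>aut\<close>, so the orbit of \<open>w\<close> meets the class of \<open>y\<close>. Since
  the orbit is itself a class, the two classes coincide.\<close>

lemma transitive_if_orbit_eq_class:
  fixes E :: "('v::finite \<times> 'v) set"
  assumes R: "equiv UNIV R" and card: "\<And>x. card (R `` {x}) = c"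
    and aut: "\<And>g. bij g \<Longrightarrow> (\<And>a b. (g a, g b) \<in> R \<longleftrightarrow> (a, b) \<in> R) \<Longrightarrow> g \<in> carrier (graph_aut E)"
    and orbit: "{g w | g. g \<in> carrier (graph_aut E)} = R `` {w}"
  shows "R `` {w} = UNIV"
proof -
  have "y \<in> R `` {w}" for y
  proof -
    obtain g where "g \<in> carrier (graph_aut E)" "(y, g w) \<in> R"
      using equiv_classes_swap[OF R, of w y] card aut by auto
    moreover from this orbit have "(w, g w) \<in> R"
      by auto
    ultimately show ?thesis
      using R by (auto simp: equiv_def dest: symD transD)
  qed
  then show ?thesis
    by auto
qed

section \<open>Strongly regular graphs with an imprimitive orbit\<close>

lemma image_neighbours_graph_aut:
  assumes "g \<in> carrier (graph_aut E)"
  shows "g ` neighbours E x = neighbours E (g x)"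
proof (intro equalityI subsetI)
  fix y assume y: "y \<in> neighbours E (g x)"
  obtain z where "y = g z"
    using assms by (meson bij_pointE mem_carrier_graph_aut)
  with y assms show "y \<in> g ` neighbours E x"
    by (auto simp: neighbours_def mem_carrier_graph_aut)
qed (use assms in \<open>auto simp: neighbours_def mem_carrier_graph_aut\<close>)

lemma image_graph_aut_orbit:
  assumes g: "g \<in> carrier (graph_aut E)"
  shows "g ` {h w | h. h \<in> carrier (graph_aut E)} = {h w | h. h \<in> carrier (graph_aut E)}"
    (is "_ ` ?X = _")
proof (intro equalityI subsetI)
  fix y assume "y \<in> g ` ?X"
  then obtain h where "h \<in> carrier (graph_aut E)" "y = (g \<circ> h) w"
    by auto
  then show "y \<in> ?X"
    using comp_graph_aut[OF g] by blast
next
  fix y assume "y \<in> ?X"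
  then obtain h where h: "h \<in> carrier (graph_aut E)" "y = h w"
    by auto
  then have "(inv_into UNIV g \<circ> h) w \<in> ?X"
    using comp_graph_aut[OF inv_graph_aut[OF g]] by blast
  moreover have "y = g ((inv_into UNIV g \<circ> h) w)"
    using g h by (simp add: mem_carrier_graph_aut bij_is_surj surj_f_inv_f)
  ultimately show "y \<in> g ` ?X"
    by blast
qed

lemma transitive_if_orbit_eq_closed_neighbourhood:
  fixes E :: "('v::finite \<times> 'v) set"
  assumes srg: "strongly_regular_params E k l m"
    and orbit: "{g w | g. g \<in> carrier (graph_aut E)} = insert w (neighbours E w)"
  shows "insert w (neighbours E w) = UNIV"
proof -
  have sym: "(x, y) \<in> E \<Longrightarrow> (y, x) \<in> E" and irrefl: "(x, x) \<notin> E"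
    and deg: "card (neighbours E x) = k"
    and l: "(x, y) \<in> E \<Longrightarrow> card (neighbours E x \<inter> neighbours E y) = l" for x y
    using srg by (auto simp: strongly_regular_params_def simple_graph_def irrefl_def dest: symD)
  obtain u v where "(u, v) \<in> E"
    using srg by (auto simp: strongly_regular_params_def)
  then have "k > 0"
    using deg[of u] by (auto simp: card_gt_0_iff neighbours_def)
  then obtain v where v: "(w, v) \<in> E"
    using deg[of w] by (auto simp: card_gt_0_iff neighbours_def)
  have "v \<in> {g w | g. g \<in> carrier (graph_aut E)}"
    using v orbit by (simp add: neighbours_def)
  then obtain g where g: "g \<in> carrier (graph_aut E)" "g w = v"
    by blast
  \<comment> \<open>\<open>g\<close> preserves the orbit, which is the closed neighbourhood of
    \<open>w\<close>, but also carries it to the closed neighbourhood of \<open>v\<close>.\<close>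
  have "insert v (neighbours E v) = insert w (neighbours E w)"
    using image_graph_aut_orbit[OF g(1), of w] image_neighbours_graph_aut[OF g(1), of w] g(2)
    unfolding orbit by simp
  then have "neighbours E w \<inter> neighbours E v = neighbours E w - {v}"
    using irrefl[of w] irrefl[of v] by (auto simp: neighbours_def)
  then have l_eq: "l = k - 1"
    using l[OF v] deg[of w] v by (simp add: card_Diff_singleton neighbours_def)
  \<comment> \<open>The value of \<open>l\<close>, found at one edge, holds at every edge: the
    common neighbours fill \<open>neighbours E x - {y}\<close> by counting. This is the transitivity
    of adjacency up to equality.\<close>
  have sub: "neighbours E x - {y} \<subseteq> neighbours E y" if "(x, y) \<in> E" for x y
  proof -
    have "neighbours E x \<inter> neighbours E y = neighbours E x - {y}"
      using l[OF that] deg[of x] that irrefl[of y]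
      by (intro card_subset_eq) (auto simp: card_Diff_singleton neighbours_def l_eq)
    then show ?thesis
      by blast
  qed
  have class_eq: "(E \<union> Id) `` {x} = insert x (neighbours E x)" for x
    by (auto simp: neighbours_def)
  have "equiv UNIV (E \<union> Id)"
  proof (rule equivI)
    show "trans (E \<union> Id)"
    proof (rule transI)
      fix x y z assume "(x, y) \<in> E \<union> Id" "(y, z) \<in> E \<union> Id"
      then show "(x, z) \<in> E \<union> Id"
        using sub[of y x] sym[of x y] by (auto simp: neighbours_def)
    qed
  qed (auto simp: refl_on_def sym_def dest: sym)
  moreover have "card ((E \<union> Id) `` {x}) = k + 1" for x
    unfolding class_eq using deg[of x] irrefl[of x] by (simp add: neighbours_def)
  moreover have "g \<in> carrier (graph_aut E)"
    if g: "bij g" "\<And>a b. (g a, g b) \<in> E \<union> Id \<longleftrightarrow> (a, b) \<in> E \<union> Id" for g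
  proof -
    \<comment> \<open>Injectivity of \<open>g\<close> and irreflexivity of \<open>E\<close> separate
      \<open>E\<close> from \<open>Id\<close>.\<close>
    have "(g a, g b) \<in> E \<longleftrightarrow> (a, b) \<in> E" for a b
      using g(2)[of a b] bij_is_inj[OF g(1)] irrefl by (auto dest: injD)
    with g(1) show ?thesis
      by (simp add: mem_carrier_graph_aut)
  qed
  ultimately show ?thesis
    using transitive_if_orbit_eq_class[of "E \<union> Id" "k + 1" E w] orbit unfolding class_eq by blast
qed

lemma transitive_if_orbit_eq_non_neighbours:
  fixes E :: "('v::finite \<times> 'v) set"
  assumes srg: "strongly_regular_params E k l m"
    and orbit: "{g w | g. g \<in> carrier (graph_aut E)} = insert w (non_neighbours E w)"
    and nontriv: "non_neighbours E w \<noteq> {}"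
  shows "insert w (non_neighbours E w) = UNIV"
proof -
  have sym: "(x, y) \<in> E \<Longrightarrow> (y, x) \<in> E" and irrefl: "(x, x) \<notin> E"
    and deg: "card (neighbours E x) = k"
    and m: "x \<noteq> y \<Longrightarrow> (x, y) \<notin> E \<Longrightarrow> card (neighbours E x \<inter> neighbours E y) = m" for x y
    using srg by (auto simp: strongly_regular_params_def simple_graph_def irrefl_def dest: symD)
  \<comment> \<open>As \<open>E\<close> is irreflexive, \<open>- E\<close> already contains the
    diagonal and is the relation of being equal or non-adjacent.\<close>
  have class_eq: "(- E) `` {x} = - neighbours E x" for x
    by (auto simp: neighbours_def)
  have closed: "insert w (non_neighbours E w) = - neighbours E w"
    using irrefl by (auto simp: neighbours_def non_neighbours_def)
  obtain v where v: "v \<noteq> w" "(w, v) \<notin> E"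
    using nontriv by (auto simp: non_neighbours_def)
  then have "v \<in> {g w | g. g \<in> carrier (graph_aut E)}"
    unfolding orbit by (simp add: non_neighbours_def)
  then obtain g where g: "g \<in> carrier (graph_aut E)" "g w = v"
    by blast
  have "- neighbours E v = - neighbours E w"
    using image_graph_aut_orbit[OF g(1), of w] image_neighbours_graph_aut[OF g(1), of w] g
    unfolding orbit closed by (simp add: mem_carrier_graph_aut bij_image_Compl_eq)
  then have m_eq: "m = k"
    using m[OF v(1)[symmetric] v(2)] deg[of w] by simp
  \<comment> \<open>With \<open>m = k\<close>, the intersection of two neighbourhoods of size
    \<open>k\<close> has size \<open>k\<close>, hence equals both.\<close>
  have same: "neighbours E x = neighbours E y" if "(x, y) \<notin> E" for x y
  proof (cases "x = y")
    case False
    have "neighbours E x \<inter> neighbours E y = neighbours E x"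
      "neighbours E x \<inter> neighbours E y = neighbours E y"
      using m[OF False that] deg[of x] deg[of y] m_eq by (intro card_subset_eq; simp)+
    then show ?thesis
      by blast
  qed simp
  have "equiv UNIV (- E)"
  proof (rule equivI)
    show "trans (- E)"
      by (rule transI) (use same in \<open>auto simp: neighbours_def\<close>)
  qed (use irrefl in \<open>auto simp: refl_on_def sym_def dest: sym\<close>)
  moreover have "card ((- E) `` {x}) = CARD('v) - k" for x
    unfolding class_eq unfolding Compl_eq_Diff_UNIV
    by (subst card_Diff_subset) (simp_all add: deg)
  moreover have "g \<in> carrier (graph_aut E)"
    if "bij g" "\<And>a b. (g a, g b) \<in> - E \<longleftrightarrow> (a, b) \<in> - E" for g
    using that by (auto simp: mem_carrier_graph_aut)
  ultimately show ?thesis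
    using transitive_if_orbit_eq_class[of "- E" "CARD('v) - k" E w] orbit
    unfolding class_eq closed by blast
qed

text \<open>The definition provides an edge and a non-edge only somewhere; regularity carries them
  to every vertex. The bound 2 appears because the complement of a neighbourhood also contains the
  vertex itself.\<close>

lemma strongly_regular_neighbours_nonempty:
  fixes E :: "('v::finite \<times> 'v) set"
  assumes "strongly_regular_params E k l m"
  shows "neighbours E w \<noteq> {}" "non_neighbours E w \<noteq> {}"
proof -
  have irrefl: "(x, x) \<notin> E" and deg: "card (neighbours E x) = k" for x
    using assms by (auto simp: strongly_regular_params_def simple_graph_def irrefl_def)
  obtain u v where "(u, v) \<in> E"
    using assms by (auto simp: strongly_regular_params_def)
  then have "k > 0"
    using deg[of u] by (auto simp: card_gt_0_iff neighbours_def)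
  then show "neighbours E w \<noteq> {}"
    using deg[of w] by auto
  obtain u v where uv: "u \<noteq> v" "(u, v) \<notin> E"
    using assms by (auto simp: strongly_regular_params_def)
  then have "card {u, v} \<le> card (- neighbours E u)"
    using irrefl by (intro card_mono) (auto simp: neighbours_def)
  moreover have "card (- neighbours E x) = CARD('v) - k" for x
    unfolding Compl_eq_Diff_UNIV by (subst card_Diff_subset) (simp_all add: deg)
  ultimately have "2 \<le> card (- neighbours E w)"
    using uv by simp
  moreover have "- neighbours E w = insert w (non_neighbours E w)"
    using irrefl by (auto simp: neighbours_def non_neighbours_def)
  ultimately show "non_neighbours E w \<noteq> {}"
    by auto
qed

section \<open>The orbit of \<omega> and the two alternatives\<close>

theorem theorem5p1:
  fixes E :: "('v::finite \<times> 'v) set" and \<omega> :: 'v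
  assumes "strongly_regular E"
    and "triple_product_span E \<omega> = terwilliger_algebra E \<omega>"
    and "terwilliger_algebra E \<omega> = stabilizer_centralizer_algebra E \<omega>"
  shows "transitive_of_rank (graph_aut E) 3 \<or>
    (graph_aut E = point_stabilizer (graph_aut E) \<omega> \<and>
     transitive_on (graph_aut E) {\<omega>} \<and>
     transitive_on (graph_aut E) (neighbours E \<omega>) \<and>
     transitive_on (graph_aut E) (non_neighbours E \<omega>))"
proof -
  let ?A = "carrier (graph_aut E)"
  let ?N = "neighbours E \<omega>" and ?M = "non_neighbours E \<omega>"
  obtain k l m where srg: "strongly_regular_params E k l m"
    using assms(1) by (auto simp: strongly_regular_def)
  have irrefl: "irrefl E"
    using srg by (auto simp: strongly_regular_params_def simple_graph_def)
  note nonempty = strongly_regular_neighbours_nonempty[OF srg, of \<omega>]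
  have disj: "\<omega> \<notin> ?N" "\<omega> \<notin> ?M" "?N \<inter> ?M = {}" and cover: "x = \<omega> \<or> x \<in> ?N \<or> x \<in> ?M" for x
    using irrefl by (auto simp: neighbours_def non_neighbours_def irrefl_def)
  have stab: "\<exists>g\<in>?A. g \<omega> = \<omega> \<and> g y = z" if "y \<in> ?N \<and> z \<in> ?N \<or> y \<in> ?M \<and> z \<in> ?M" for y z
    using that assms irrefl disj
    by (intro stabilizer_orbit_if_span_eq_centralizer)
      (auto simp: neighbours_def non_neighbours_def)
  have imN: "g ` ?N = ?N" if "g \<in> ?A" "g \<omega> = \<omega>" for g
    using image_neighbours_graph_aut[OF that(1), of \<omega>] that(2) by simp
  have M_eq: "?M = - insert \<omega> ?N"
    using disj cover by blast
  have imM: "g ` ?M = ?M" if g: "g \<in> ?A" "g \<omega> = \<omega>" for g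
    unfolding M_eq using imN[OF g] g
    by (simp add: mem_carrier_graph_aut bij_image_Compl_eq)
  define X where "X = {g \<omega> | g. g \<in> ?A}"
  have "id \<omega> \<in> X"
    unfolding X_def using id_graph_aut[of E] by blast
  then have \<omega>X: "\<omega> \<in> X"
    by simp
  have closed: "g x \<in> X" if "g \<in> ?A" "x \<in> X" for g x
    using image_graph_aut_orbit[OF that(1), of \<omega>] that(2) unfolding X_def[symmetric] by blast
  \<comment> \<open>The stabilizer of \<omega> is transitive on each cell, so an invariant set
    meeting a cell contains it.\<close>
  have NX: "?N \<subseteq> X \<or> ?N \<inter> X = {}" and MX: "?M \<subseteq> X \<or> ?M \<inter> X = {}"
    using stab closed by (metis disjoint_iff subsetI)+
  have X_cases: "X = UNIV \<or> X = {\<omega>} \<or> X = insert \<omega> ?N \<or> X = insert \<omega> ?M"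
  proof -
    have "X = insert \<omega> ((?N \<inter> X) \<union> (?M \<inter> X))"
      using \<omega>X cover by blast
    moreover have "insert \<omega> (?N \<union> ?M) = UNIV"
      using cover by blast
    moreover have "?N \<inter> X = ?N \<or> ?N \<inter> X = {}" "?M \<inter> X = ?M \<or> ?M \<inter> X = {}"
      using NX MX by blast+
    ultimately show ?thesis
      by (metis Un_empty_left Un_empty_right)
  qed
  have "X = UNIV" if "X = insert \<omega> ?N"
    using transitive_if_orbit_eq_closed_neighbourhood[OF srg, of \<omega>] that by (simp add: X_def)
  moreover have "X = UNIV" if "X = insert \<omega> ?M"
    using transitive_if_orbit_eq_non_neighbours[OF srg, of \<omega>] that nonempty(2)
    by (simp add: X_def)
  ultimately have "X = UNIV \<or> X = {\<omega>}"
    using X_cases by blast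
  then show ?thesis
  proof
    assume X: "X = UNIV"
    have from_\<omega>: "\<exists>g\<in>?A. g \<omega> = x" for x
    proof -
      have "x \<in> X"
        by (simp add: X)
      then show ?thesis
        unfolding X_def by blast
    qed
    have "transitive_on (graph_aut E) UNIV"
    proof (rule transitive_on_graph_autI)
      fix x y
      \<comment> \<open>Any two points are joined through \<omega>: back along \<open>g\<close>,
        then out along \<open>h\<close>.\<close>
      obtain g h where gh: "g \<in> ?A" "g \<omega> = x" "h \<in> ?A" "h \<omega> = y"
        using from_\<omega> by metis
      then have "inv_into UNIV g x = \<omega>"
        by (auto simp: mem_carrier_graph_aut bij_is_inj)
      then have "(h \<circ> inv_into UNIV g) x = y" "h \<circ> inv_into UNIV g \<in> ?A"
        using gh by (auto intro: comp_graph_aut inv_graph_aut)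
      then show "\<exists>g\<in>?A. g x = y"
        by blast
    qed (simp add: mem_carrier_graph_aut bij_is_surj)
    \<comment> \<open>The orbits are counted at \<omega>, where they are the three cells, and the
      number is carried to \<open>x\<close> by conjugation.\<close>
    moreover have "card (orbits (point_stabilizer (graph_aut E) x) UNIV (\<lambda>g. g)) = 3" for x
    proof -
      let ?orb = "orbit (point_stabilizer (graph_aut E) \<omega>) (\<lambda>g. g)"
      have orb: "?orb y = {g y | g. g \<in> ?A \<and> g \<omega> = \<omega>}" for y
        by (auto simp: orbit_def carrier_point_stabilizer)
      have "?orb \<omega> = {\<omega>}"
        unfolding orb by (auto intro: exI[of _ id] simp: id_graph_aut)
      moreover have orbN: "?orb y = ?N" if "y \<in> ?N" for y
        unfolding orb using stab[of y] imN that by blast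
      moreover have orbM: "?orb y = ?M" if "y \<in> ?M" for y
        unfolding orb using stab[of y] imM that by blast
      moreover have "orbits (point_stabilizer (graph_aut E) \<omega>) UNIV (\<lambda>g. g) =
          ?orb ` ({\<omega>} \<union> ?N \<union> ?M)"
      proof -
        have "{\<omega>} \<union> ?N \<union> ?M = UNIV"
          using cover by blast
        then show ?thesis
          by (auto simp: orbits_def)
      qed
      moreover have "?orb ` ?N = {?N}" "?orb ` ?M = {?M}"
        using nonempty orbN orbM by (auto simp: image_iff)
      ultimately have "orbits (point_stabilizer (graph_aut E) \<omega>) UNIV (\<lambda>g. g) = {{\<omega>}, ?N, ?M}"
        by (simp add: image_Un insert_commute)
      \<comment> \<open>Non-emptiness enters here: without it \<open>?N\<close> and
        \<open>?M\<close> could coincide as empty sets.\<close>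
      moreover have "{\<omega>} \<noteq> ?N" "{\<omega>} \<noteq> ?M" "?N \<noteq> ?M"
        using disj nonempty by auto
      ultimately have "card (orbits (point_stabilizer (graph_aut E) \<omega>) UNIV (\<lambda>g. g)) = 3"
        by simp
      then show ?thesis
        using from_\<omega>[of x] card_orbits_point_stabilizer_eq by metis
    qed
    ultimately show ?thesis
      by (simp add: transitive_of_rank_def)
  next
    assume X: "X = {\<omega>}"
    then have fix\<omega>: "g \<omega> = \<omega>" if "g \<in> ?A" for g
      using that by (auto simp: X_def)
    then have "?A = carrier (point_stabilizer (graph_aut E) \<omega>)"
      by (auto simp: carrier_point_stabilizer)
    \<comment> \<open>A point stabilizer differs from the group only in its \<open>carrier\<close>
      field, so equal carriers give equal records.\<close>
    then have "graph_aut E = point_stabilizer (graph_aut E) \<omega>"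
      by (simp add: point_stabilizer_def)
    moreover have "transitive_on (graph_aut E) {\<omega>}"
      using fix\<omega> id_graph_aut[of E] by (intro transitive_on_graph_autI) auto
    moreover have "transitive_on (graph_aut E) ?N"
      using imN fix\<omega> stab by (intro transitive_on_graph_autI) blast+
    moreover have "transitive_on (graph_aut E) ?M"
      using imM fix\<omega> stab by (intro transitive_on_graph_autI) blast+
    ultimately show ?thesis
      by blast
  qed
qed

end
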